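(* Let $U\colon[0,1]^2\to[0,1]$ be a uninorm with neutral element $e$ and $U\in\mathcal{U}$. Then there exists a symmetric, surjective, non-increasing set-valued function $r$ on $[0,1]$ such that, with $R=G(r)$ the graph of $r$, $U$ is continuous on $[0,1]^2\setminus R$, and $U(x,y)=e$ implies $(x,y)\in R$. Moreover, at each point $(x,y)\in[0,1]^2$ the uninorm $U$ is either left-continuous or right-continuous.
   Context: A uninorm is a function $U\colon[0,1]^2\to[0,1]$ which is commutative, associative, non-decreasing (not necessarily strictly) in both variables and has a neutral element $e\in(0,1)$, i.e. $U(e,x)=x$ for all $x\in[0,1]$. For a uninorm $U$ with neutral element $e$, its underlying t-norm and t-conorm are $T_U(x,y)=\frac{1}{e}U(ex,ey)$ and $S_U(x,y)=\frac{U(e+(1-e)x,\,e+(1-e)y)-e}{1-e}$ for $x,y\in[0,1]$. $\mathcal{U}$ denotes the set of all uninorms $U$ such that both $T_U$ and $S_U$ are continuous on $[0,1]^2$. "$U$ is continuous on a set $M\subseteq[0,1]^2$" means that $U$, as a function on $[0,1]^2$, is continuous at every point of $M$. A set-valued function on $[0,1]$ is a mapping $p\colon[0,1]\to\mathcal{P}([0,1])$. It is non-increasing if for all $x_1<x_2$ in $[0,1]$ we have $y_1\ge y_2$ for all $y_1\in p(x_1)$ and all $y_2\in p(x_2)$; symmetric if $y\in p(x)$ if and only if $x\in p(y)$; surjective if for every $y\in[0,1]$ there is an $x\in[0,1]$ with $y\in p(x)$. Its graph is $G(p)=\{(x,y)\in[0,1]^2\mid y\in p(x)\}$. $U$ is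 left-continuous at $(x_0,y_0)\in[0,1]^2$ if for every $\varepsilon>0$ there is $\delta>0$ such that $|U(x,y)-U(x_0,y_0)|<\varepsilon$ for all $(x,y)\in[0,1]^2$ with $x\in[x_0-\delta,x_0]$, $y\in[y_0-\delta,y_0]$. Right-continuity at $(x_0,y_0)$ is defined in the same way with $x\in[x_0,x_0+\delta]$, $y\in[y_0,y_0+\delta]$. *)

theory Defs
  imports "HOL-Analysis.Analysis"
begin

text \<open>
  Functions on the unit square are rendered as curried functions on the reals, and set-valued
  functions on the unit interval as functions from the reals to sets of reals. Their values outside
  the unit interval are unspecified and never referred to.
\<close>

abbreviation unit_square :: "(real \<times> real) set"
  where "unit_square \<equiv> {0..1} \<times> {0..1}"

definition uninorm :: "(real \<Rightarrow> real \<Rightarrow> real) \<Rightarrow> real \<Rightarrow> bool"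
  where "uninorm U e \<longleftrightarrow>
    (\<forall>x\<in>{0..1}. \<forall>y\<in>{0..1}. U x y \<in> {0..1}) \<and>
    (\<forall>x\<in>{0..1}. \<forall>y\<in>{0..1}. U x y = U y x) \<and>
    (\<forall>x\<in>{0..1}. \<forall>y\<in>{0..1}. \<forall>z\<in>{0..1}. U (U x y) z = U x (U y z)) \<and>
    (\<forall>x\<in>{0..1}. \<forall>x'\<in>{0..1}. \<forall>y\<in>{0..1}. \<forall>y'\<in>{0..1}.
       x \<le> x' \<longrightarrow> y \<le> y' \<longrightarrow> U x y \<le> U x' y') \<and>
    e \<in> {0<..<1} \<and>
    (\<forall>x\<in>{0..1}. U e x = x)"

definition underlying_tnorm :: "(real \<Rightarrow> real \<Rightarrow> real) \<Rightarrow> real \<Rightarrow> real \<Rightarrow> real \<Rightarrow> real"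
  where "underlying_tnorm U e x y = (1 / e) * U (e * x) (e * y)"

definition underlying_tconorm :: "(real \<Rightarrow> real \<Rightarrow> real) \<Rightarrow> real \<Rightarrow> real \<Rightarrow> real \<Rightarrow> real"
  where "underlying_tconorm U e x y = (U (e + (1 - e) * x) (e + (1 - e) * y) - e) / (1 - e)"

text \<open>The neutral element of a uninorm is unique, so the quantifier over \<open>e\<close> is harmless.\<close>

definition uninorms_cont_underlying :: "(real \<Rightarrow> real \<Rightarrow> real) set"
  where "uninorms_cont_underlying =
    {U. \<exists>e. uninorm U e \<and>
         continuous_on unit_square (\<lambda>(x, y). underlying_tnorm U e x y) \<and>
         continuous_on unit_square (\<lambda>(x, y). underlying_tconorm U e x y)}"

text \<open>
  Continuity at each point of \<open>M\<close> of the function on the whole unit square. This is stronger than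
  continuity of the restriction to \<open>M\<close>, which is what \<open>continuous_on M\<close> would say.
\<close>

definition continuous_at_points_of :: "(real \<times> real) set \<Rightarrow> (real \<Rightarrow> real \<Rightarrow> real) \<Rightarrow> bool"
  where "continuous_at_points_of M U \<longleftrightarrow>
    (\<forall>p\<in>M. continuous (at p within unit_square) (\<lambda>(x, y). U x y))"

definition set_valued_function :: "(real \<Rightarrow> real set) \<Rightarrow> bool"
  where "set_valued_function p \<longleftrightarrow> (\<forall>x\<in>{0..1}. p x \<subseteq> {0..1})"

definition non_increasing :: "(real \<Rightarrow> real set) \<Rightarrow> bool"
  where "non_increasing p \<longleftrightarrow>
    (\<forall>x1\<in>{0..1}. \<forall>x2\<in>{0..1}. x1 < x2 \<longrightarrow> (\<forall>y1\<in>p x1. \<forall>y2\<in>p x2. y1 \<ge> y2))"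

definition symmetric :: "(real \<Rightarrow> real set) \<Rightarrow> bool"
  where "symmetric p \<longleftrightarrow> (\<forall>x\<in>{0..1}. \<forall>y\<in>{0..1}. y \<in> p x \<longleftrightarrow> x \<in> p y)"

definition surjective :: "(real \<Rightarrow> real set) \<Rightarrow> bool"
  where "surjective p \<longleftrightarrow> (\<forall>y\<in>{0..1}. \<exists>x\<in>{0..1}. y \<in> p x)"

definition graph_of :: "(real \<Rightarrow> real set) \<Rightarrow> (real \<times> real) set"
  where "graph_of p = {(x, y). (x, y) \<in> unit_square \<and> y \<in> p x}"

definition left_continuous_at :: "(real \<Rightarrow> real \<Rightarrow> real) \<Rightarrow> real \<Rightarrow> real \<Rightarrow> bool"
  where "left_continuous_at U x0 y0 \<longleftrightarrow>
    (\<forall>\<epsilon>>0. \<exists>\<delta>>0. \<forall>x\<in>{0..1}. \<forall>y\<in>{0..1}.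
       x \<in> {x0 - \<delta>..x0} \<longrightarrow> y \<in> {y0 - \<delta>..y0} \<longrightarrow> \<bar>U x y - U x0 y0\<bar> < \<epsilon>)"

definition right_continuous_at :: "(real \<Rightarrow> real \<Rightarrow> real) \<Rightarrow> real \<Rightarrow> real \<Rightarrow> bool"
  where "right_continuous_at U x0 y0 \<longleftrightarrow>
    (\<forall>\<epsilon>>0. \<exists>\<delta>>0. \<forall>x\<in>{0..1}. \<forall>y\<in>{0..1}.
       x \<in> {x0..x0 + \<delta>} \<longrightarrow> y \<in> {y0..y0 + \<delta>} \<longrightarrow> \<bar>U x y - U x0 y0\<bar> < \<epsilon>)"

end

theory Submission
  imports Defs
begin

text \<open>
  Everything rests on one consequence of associativity. Let \<open>c = U a b \<ge> e\<close>. Continuity of the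
  underlying t-conorm makes \<open>t \<mapsto> U c t\<close> map \<open>[e, 1]\<close> onto \<open>[c, 1]\<close>, and since
  \<open>U c t = U a (U b t)\<close> with \<open>U b t \<ge> b\<close>, the section \<open>U a\<close> maps \<open>[b, 1]\<close> onto
  \<open>[U a b, 1]\<close> (\<open>section_onto_above\<close>). A monotone map onto an interval cannot jump, so
  above a point where \<open>U \<ge> e\<close> both families of sections are continuous, and by monotonicity \<open>U\<close>
  is jointly continuous there. The reflection \<open>(x, y) \<mapsto> 1 - U (1 - x) (1 - y)\<close> carries the
  same statements to the region below a point where \<open>U \<le> e\<close>.

  One-sided continuity is then immediate: \<open>U\<close> is right-continuous where \<open>U \<ge> e\<close> and
  left-continuous where \<open>U \<le> e\<close>. For the set-valued function take the border between the two
  regions: \<open>y \<in> r x\<close> if \<open>U \<le> e\<close> at all points strictly below \<open>(x, y)\<close> in both coordinates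
  and \<open>U \<ge> e\<close> at all points strictly above. Outside the graph there is, on one of the two sides, a
  point strictly beyond \<open>(x, y)\<close> that puts a whole neighbourhood of \<open>(x, y)\<close> into a region of
  continuity. The function \<open>r\<close> is non-increasing because otherwise \<open>U\<close> would equal \<open>e\<close> on an open
  rectangle, while inverses in a monoid are unique.
\<close>

section \<open>Uninorms with solvable underlying equations\<close>

text \<open>
  The two solvability conditions are all that is used of the continuity of the underlying t-norm
  and t-conorm. Reflection of the unit square interchanges them, so the locale is self-dual.
\<close>

locale solvable_uninorm =
  fixes U :: "real \<Rightarrow> real \<Rightarrow> real" and e :: real
  assumes uninorm: "uninorm U e"
    and solvable_above: "\<lbrakk>e \<le> c; c \<le> v; v \<le> 1\<rbrakk> \<Longrightarrow> \<exists>t\<in>{e..1}. U c t = v"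
    and solvable_below: "\<lbrakk>0 \<le> v; v \<le> c; c \<le> e\<rbrakk> \<Longrightarrow> \<exists>t\<in>{0..e}. U c t = v"
begin

lemma closed: "\<lbrakk>x \<in> {0..1}; y \<in> {0..1}\<rbrakk> \<Longrightarrow> U x y \<in> {0..1}"
  and commute: "\<lbrakk>x \<in> {0..1}; y \<in> {0..1}\<rbrakk> \<Longrightarrow> U x y = U y x"
  and assoc: "\<lbrakk>x \<in> {0..1}; y \<in> {0..1}; z \<in> {0..1}\<rbrakk> \<Longrightarrow> U (U x y) z = U x (U y z)"
  and neutral_bounds: "e \<in> {0<..<1}"
  and neutral_left: "x \<in> {0..1} \<Longrightarrow> U e x = x"
  using uninorm unfolding uninorm_def by blast+

lemma mono:
  "\<lbrakk>x \<in> {0..1}; x' \<in> {0..1}; y \<in> {0..1}; y' \<in> {0..1}; x \<le> x'; y \<le> y'\<rbrakk> \<Longrightarrow> U x y \<le> U x' y'"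
  using uninorm unfolding uninorm_def by blast

lemma neutral_in: "e \<in> {0..1}"
  using neutral_bounds by auto

lemma neutral_right: "x \<in> {0..1} \<Longrightarrow> U x e = x"
  using neutral_left commute neutral_in by metis

lemma solvable_uninorm_reflect: "solvable_uninorm (\<lambda>x y. 1 - U (1 - x) (1 - y)) (1 - e)"
proof
  show "uninorm (\<lambda>x y. 1 - U (1 - x) (1 - y)) (1 - e)"
    unfolding uninorm_def
  proof (intro conjI ballI impI)
    fix x y :: real assume "x \<in> {0..1}" "y \<in> {0..1}"
    then have xy: "1 - x \<in> {0..1}" "1 - y \<in> {0..1}" by auto
    show "1 - U (1 - x) (1 - y) \<in> {0..1}"
      using closed[OF xy] by auto
    show "1 - U (1 - x) (1 - y) = 1 - U (1 - y) (1 - x)"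
      using commute[OF xy] by simp
    {
      fix z :: real assume "z \<in> {0..1}"
      then have "1 - z \<in> {0..1}" by auto
      then show "1 - U (1 - (1 - U (1 - x) (1 - y))) (1 - z) =
          1 - U (1 - x) (1 - (1 - U (1 - y) (1 - z)))"
        using assoc xy by simp
    }
    {
      fix x' y' :: real assume "x' \<in> {0..1}" "y' \<in> {0..1}" "x \<le> x'" "y \<le> y'"
      moreover from this have "1 - x' \<in> {0..1}" "1 - y' \<in> {0..1}" by auto
      ultimately show "1 - U (1 - x) (1 - y) \<le> 1 - U (1 - x') (1 - y')"
        using mono[of "1 - x'" "1 - x" "1 - y'" "1 - y"] xy by simp
    }
  next
    show "1 - e \<in> {0<..<1}" using neutral_bounds by auto
  next
    fix x :: real assume "x \<in> {0..1}"
    then show "1 - U (1 - (1 - e)) (1 - x) = x" using neutral_left[of "1 - x"] by auto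
  qed
next
  fix c v :: real assume "1 - e \<le> c" "c \<le> v" "v \<le> 1"
  then obtain t where "t \<in> {0..e}" "U (1 - c) t = 1 - v"
    using solvable_below[of "1 - v" "1 - c"] by auto
  then show "\<exists>t\<in>{1 - e..1}. 1 - U (1 - c) (1 - t) = v"
    by (intro bexI[of _ "1 - t"]) auto
next
  fix c v :: real assume "0 \<le> v" "v \<le> c" "c \<le> 1 - e"
  then obtain t where "t \<in> {e..1}" "U (1 - c) t = 1 - v"
    using solvable_above[of "1 - c" "1 - v"] by auto
  then show "\<exists>t\<in>{0..1 - e}. 1 - U (1 - c) (1 - t) = v"
    by (intro bexI[of _ "1 - t"]) auto
qed

section \<open>Continuity on either side of the neutral level\<close>

lemma section_onto_above:
  assumes "a \<in> {0..1}" "b \<in> {0..1}" "e \<le> U a b" "U a b \<le> v" "v \<le> 1"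
  shows "\<exists>y\<in>{b..1}. U a y = v"
proof -
  \<comment> \<open>Solve the equation at \<open>U a b\<close>; associativity moves the solution into the second argument.\<close>
  obtain t where t: "t \<in> {e..1}" "U (U a b) t = v"
    using solvable_above assms by blast
  have t01: "t \<in> {0..1}" using t(1) neutral_in by auto
  have "U a (U b t) = v"
    using t(2) assoc assms(1,2) t01 by simp
  moreover have "b \<le> U b t"
    using mono[of b b e t] neutral_right[of b] assms(2) t t01 neutral_in by auto
  moreover have "U b t \<le> 1"
    using closed[of b t] assms(2) t01 by auto
  ultimately show ?thesis by auto
qed

text \<open>A jump of the section at \<open>b\<close> from the right would leave a gap in its range.\<close>

lemma section_upper_semicontinuous:
  assumes ab: "a \<in> {0..1}" "b \<in> {0..1}" and "e \<le> U a b" "U a b < w"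
  obtains \<delta> where "\<delta> > 0" "\<And>y. \<lbrakk>y \<in> {0..1}; y \<le> b + \<delta>\<rbrakk> \<Longrightarrow> U a y < w"
proof (cases "w > 1")
  case True
  then have "U a y < w" if "y \<in> {0..1}" for y
    using closed[OF ab(1) that] by auto
  then show thesis using that[of 1] by auto
next
  case False
  define v where "v = (U a b + w) / 2"
  obtain y' where y': "y' \<in> {b..1}" "U a y' = v"
    using section_onto_above[of a b v] assms False by (auto simp: v_def)
  have "b < y'"
    using y' assms(4) by (cases "y' = b") (auto simp: v_def)
  moreover have "U a y < w" if "y \<in> {0..1}" "y \<le> b + (y' - b)" for y
    using mono[of a a y y'] that y' ab assms(4) by (auto simp: v_def)
  ultimately show thesis using that[of "y' - b"] by auto
qed

text \<open>
  Continuity from the left at \<open>y\<close> additionally needs room below \<open>y\<close> in which \<open>U a \<ge> e\<close> persists,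
  which is what the point \<open>b < y\<close> provides.
\<close>

lemma section_lower_semicontinuous:
  assumes ab: "a \<in> {0..1}" "b \<in> {0..1}" and "e \<le> U a b"
    and y: "y \<in> {0..1}" "b < y" and w: "w < U a y"
  obtains y' where "y' \<in> {b..<y}" "w < U a y'"
proof (cases "w < U a b")
  case True
  then show thesis using that[of b] y by auto
next
  case False
  define v where "v = (w + U a y) / 2"
  have "U a y \<le> 1" using closed[OF ab(1) y(1)] by auto
  then obtain y' where y': "y' \<in> {b..1}" "U a y' = v"
    using section_onto_above[of a b v] assms False by (auto simp: v_def)
  have "y' < y"
  proof (rule ccontr)
    assume "\<not> y' < y"
    then have "U a y \<le> U a y'" using mono[of a a y y'] y' y ab by auto
    then show False using y'(2) w by (simp add: v_def)
  qed
  then show thesis using that[of y'] y' w by (auto simp: v_def)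
qed

text \<open>
  For joint semicontinuity, move along one section and then along a perpendicular one. The corner
  reached after the first move still satisfies \<open>U \<ge> e\<close>, so the second section cannot jump either.
\<close>

lemma upper_semicontinuous:
  assumes xy: "x \<in> {0..1}" "y \<in> {0..1}" and ge: "e \<le> U x y" and "U x y < w"
  obtains \<delta> where "\<delta> > 0"
    "\<And>x' y'. \<lbrakk>x' \<in> {0..1}; y' \<in> {0..1}; x' \<le> x + \<delta>; y' \<le> y + \<delta>\<rbrakk> \<Longrightarrow> U x' y' < w"
proof -
  obtain d1 where d1: "d1 > 0" "\<And>y'. \<lbrakk>y' \<in> {0..1}; y' \<le> y + d1\<rbrakk> \<Longrightarrow> U x y' < w"
    using section_upper_semicontinuous assms by metis
  define y1 where "y1 = min 1 (y + d1)"
  have y1: "y1 \<in> {0..1}" "y \<le> y1" using d1(1) xy(2) by (auto simp: y1_def)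
  have "e \<le> U y1 x"
    using mono[of x x y y1] commute[of x y1] ge xy y1 by auto
  moreover have "U y1 x < w"
    using d1(2)[OF y1(1)] commute[of x y1] xy(1) y1 by (auto simp: y1_def)
  ultimately obtain d2 where d2: "d2 > 0" "\<And>x'. \<lbrakk>x' \<in> {0..1}; x' \<le> x + d2\<rbrakk> \<Longrightarrow> U y1 x' < w"
    using section_upper_semicontinuous xy y1 by metis
  have "U x' y' < w"
    if "x' \<in> {0..1}" "y' \<in> {0..1}" "x' \<le> x + min d1 d2" "y' \<le> y + min d1 d2" for x' y'
  proof -
    have "U x' y' \<le> U x' y1" using mono[of x' x' y' y1] that y1 by (auto simp: y1_def)
    also have "\<dots> = U y1 x'" using commute that y1 by auto
    also have "\<dots> < w" using d2(2) that by auto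
    finally show ?thesis .
  qed
  then show thesis using that[of "min d1 d2"] d1(1) d2(1) by auto
qed

lemma lower_semicontinuous:
  assumes ab: "a \<in> {0..1}" "b \<in> {0..1}" and ge: "e \<le> U a b"
    and xy: "x \<in> {0..1}" "y \<in> {0..1}" "a < x" "b < y" and w: "w < U x y"
  obtains \<delta> where "\<delta> > 0"
    "\<And>x' y'. \<lbrakk>x' \<in> {0..1}; y' \<in> {0..1}; x - \<delta> \<le> x'; y - \<delta> \<le> y'\<rbrakk> \<Longrightarrow> w < U x' y'"
proof -
  have "e \<le> U x b" using mono[of a x b b] ab ge xy by auto
  then obtain y1 where y1: "y1 \<in> {b..<y}" "w < U x y1"
    using section_lower_semicontinuous[of x b y w] ab xy w by auto
  have y1': "y1 \<in> {0..1}" using y1 ab xy by auto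
  have "e \<le> U y1 a" using mono[of a a b y1] commute[of a y1] ab ge y1 y1' by auto
  moreover have "w < U y1 x" using y1 y1' commute xy(1) by auto
  ultimately obtain x1 where x1: "x1 \<in> {a..<x}" "w < U y1 x1"
    using section_lower_semicontinuous[of y1 a x w] y1' ab xy by auto
  have x1': "x1 \<in> {0..1}" using x1 ab xy by auto
  have "w < U x' y'" if "x' \<in> {0..1}" "y' \<in> {0..1}" "x1 \<le> x'" "y1 \<le> y'" for x' y'
    using mono[of x1 x' y1 y'] x1 commute[of x1 y1] that x1' y1' by auto
  then show thesis using that[of "min (x - x1) (y - y1)"] x1 y1 by auto
qed

lemma right_continuous_if_ge:
  assumes "x \<in> {0..1}" "y \<in> {0..1}" "e \<le> U x y"
  shows "right_continuous_at U x y"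
  unfolding right_continuous_at_def
proof (intro allI impI)
  fix \<epsilon> :: real assume "\<epsilon> > 0"
  then obtain \<delta> where d: "\<delta> > 0" "\<And>x' y'. \<lbrakk>x' \<in> {0..1}; y' \<in> {0..1}; x' \<le> x + \<delta>; y' \<le> y + \<delta>\<rbrakk>
      \<Longrightarrow> U x' y' < U x y + \<epsilon>"
    using upper_semicontinuous[of x y "U x y + \<epsilon>"] assms by auto
  have "\<bar>U x' y' - U x y\<bar> < \<epsilon>"
    if "x' \<in> {0..1}" "y' \<in> {0..1}" "x' \<in> {x..x + \<delta>}" "y' \<in> {y..y + \<delta>}" for x' y'
    using d(2)[of x' y'] mono[of x x' y y'] that assms \<open>\<epsilon> > 0\<close> by auto
  then show "\<exists>\<delta>>0. \<forall>x'\<in>{0..1}. \<forall>y'\<in>{0..1}. x' \<in> {x..x + \<delta>} \<longrightarrow> y' \<in> {y..y + \<delta>} \<longrightarrow>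
      \<bar>U x' y' - U x y\<bar> < \<epsilon>"
    using d(1) by blast
qed

lemma left_continuous_if_le:
  assumes "x \<in> {0..1}" "y \<in> {0..1}" "U x y \<le> e"
  shows "left_continuous_at U x y"
  unfolding left_continuous_at_def
proof (intro allI impI)
  interpret reflected: solvable_uninorm "\<lambda>x y. 1 - U (1 - x) (1 - y)" "1 - e"
    by (rule solvable_uninorm_reflect)
  fix \<epsilon> :: real assume "\<epsilon> > 0"
  moreover have "right_continuous_at (\<lambda>x y. 1 - U (1 - x) (1 - y)) (1 - x) (1 - y)"
    by (rule reflected.right_continuous_if_ge) (use assms in auto)
  ultimately obtain \<delta> where d: "\<delta> > 0" "\<And>x' y'. \<lbrakk>x' \<in> {0..1}; y' \<in> {0..1};
      x' \<in> {1 - x..1 - x + \<delta>}; y' \<in> {1 - y..1 - y + \<delta>}\<rbrakk> \<Longrightarrow>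
      \<bar>(1 - U (1 - x') (1 - y')) - (1 - U x y)\<bar> < \<epsilon>"
    unfolding right_continuous_at_def by fastforce
  have "\<bar>U x' y' - U x y\<bar> < \<epsilon>"
    if "x' \<in> {0..1}" "y' \<in> {0..1}" "x' \<in> {x - \<delta>..x}" "y' \<in> {y - \<delta>..y}" for x' y'
    using d(2)[of "1 - x'" "1 - y'"] that by auto
  then show "\<exists>\<delta>>0. \<forall>x'\<in>{0..1}. \<forall>y'\<in>{0..1}. x' \<in> {x - \<delta>..x} \<longrightarrow> y' \<in> {y - \<delta>..y} \<longrightarrow>
      \<bar>U x' y' - U x y\<bar> < \<epsilon>"
    using d(1) by blast
qed

lemma continuous_strictly_above:
  assumes ab: "a \<in> {0..1}" "b \<in> {0..1}" and ge: "e \<le> U a b"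
    and xy: "x \<in> {0..1}" "y \<in> {0..1}" "a < x" "b < y"
  shows "continuous (at (x, y) within unit_square) (\<lambda>(x, y). U x y)"
  unfolding continuous_within_eps_delta
proof (intro allI impI)
  fix \<epsilon> :: real assume "\<epsilon> > 0"
  have "e \<le> U x y" using mono[of a x b y] ab ge xy by auto
  then obtain d1 where d1: "d1 > 0" "\<And>x' y'. \<lbrakk>x' \<in> {0..1}; y' \<in> {0..1}; x' \<le> x + d1; y' \<le> y + d1\<rbrakk>
      \<Longrightarrow> U x' y' < U x y + \<epsilon>"
    using upper_semicontinuous[of x y "U x y + \<epsilon>"] xy \<open>\<epsilon> > 0\<close> by auto
  obtain d2 where d2: "d2 > 0" "\<And>x' y'. \<lbrakk>x' \<in> {0..1}; y' \<in> {0..1}; x - d2 \<le> x'; y - d2 \<le> y'\<rbrakk>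
      \<Longrightarrow> U x y - \<epsilon> < U x' y'"
    using lower_semicontinuous[OF ab ge xy, of "U x y - \<epsilon>"] \<open>\<epsilon> > 0\<close> by auto
  have "dist (U x' y') (U x y) < \<epsilon>"
    if "x' \<in> {0..1}" "y' \<in> {0..1}" "dist (x', y') (x, y) < min d1 d2" for x' y'
  proof -
    have "\<bar>x' - x\<bar> < min d1 d2" "\<bar>y' - y\<bar> < min d1 d2"
      using dist_fst_le[of "(x', y')" "(x, y)"] dist_snd_le[of "(x', y')" "(x, y)"] that(3)
      by (auto simp: dist_real_def)
    then have "U x' y' < U x y + \<epsilon>" "U x y - \<epsilon> < U x' y'"
      using d1(2)[of x' y'] d2(2)[of x' y'] that(1,2) by linarith+
    then show ?thesis by (simp add: dist_real_def abs_less_iff)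
  qed
  then show "\<exists>d>0. \<forall>q\<in>unit_square. dist q (x, y) < d \<longrightarrow>
      dist (case q of (x, y) \<Rightarrow> U x y) (case (x, y) of (x, y) \<Rightarrow> U x y) < \<epsilon>"
    using d1(1) d2(1) by (intro exI[of _ "min d1 d2"]) auto
qed

lemma continuous_strictly_below:
  assumes ab: "a \<in> {0..1}" "b \<in> {0..1}" and le: "U a b \<le> e"
    and xy: "x \<in> {0..1}" "y \<in> {0..1}" "x < a" "y < b"
  shows "continuous (at (x, y) within unit_square) (\<lambda>(x, y). U x y)"
proof -
  interpret reflected: solvable_uninorm "\<lambda>x y. 1 - U (1 - x) (1 - y)" "1 - e"
    by (rule solvable_uninorm_reflect)
  let ?refl = "\<lambda>p :: real \<times> real. (1 - fst p, 1 - snd p)"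
  have img: "?refl ` unit_square = unit_square"
  proof
    show "unit_square \<subseteq> ?refl ` unit_square"
    proof
      fix p :: "real \<times> real" assume "p \<in> unit_square"
      then have "?refl p \<in> unit_square" "p = ?refl (?refl p)" by auto
      then show "p \<in> ?refl ` unit_square" by blast
    qed
  qed auto
  have "continuous (at (1 - x, 1 - y) within unit_square)
      (\<lambda>(x, y). 1 - U (1 - x) (1 - y))"
    by (rule reflected.continuous_strictly_above[of "1 - a" "1 - b"]) (use assms in auto)
  then have "continuous (at (?refl (x, y)) within ?refl ` unit_square)
      (\<lambda>(x, y). 1 - U (1 - x) (1 - y))"
    unfolding img by simp
  moreover have "continuous (at (x, y) within unit_square) ?refl"
    by (intro continuous_intros)
  ultimately have "continuous (at (x, y) within unit_square)
      ((\<lambda>(x, y). 1 - U (1 - x) (1 - y)) \<circ> ?refl)"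
    by (rule continuous_within_compose[rotated])
  then have "continuous (at (x, y) within unit_square) (\<lambda>p. 1 - (case p of (x, y) \<Rightarrow> 1 - U x y))"
    by (intro continuous_intros) (simp add: o_def case_prod_unfold)
  then show ?thesis by (simp add: case_prod_unfold)
qed

section \<open>The border between the values below and above the neutral element\<close>

definition border :: "real \<Rightarrow> real set"
  where "border x = {y \<in> {0..1}.
    (\<forall>x'\<in>{0..<x}. \<forall>y'\<in>{0..<y}. U x' y' \<le> e) \<and> (\<forall>x'\<in>{x<..1}. \<forall>y'\<in>{y<..1}. e \<le> U x' y')}"

lemma inverse_unique:
  assumes "a \<in> {0..1}" "a' \<in> {0..1}" "b \<in> {0..1}" "U a b = e" "U a' b = e"
  shows "a = a'"
proof -
  have "a = U a (U a' b)" using assms neutral_right by simp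
  also have "\<dots> = U (U a b) a'"
    using assoc[of a b a'] commute[of a' b] assms(1-3) by metis
  also have "\<dots> = a'" using assms neutral_left by simp
  finally show ?thesis .
qed

lemma symmetric_border: "symmetric border"
proof -
  have "x \<in> border y" if "x \<in> {0..1}" "y \<in> {0..1}" "y \<in> border x" for x y
  proof -
    have "U y' x' \<le> e" if "x' \<in> {0..<x}" "y' \<in> {0..<y}" for x' y'
    proof -
      have "U y' x' = U x' y'" using commute[of x' y'] that \<open>x \<in> {0..1}\<close> \<open>y \<in> {0..1}\<close> by auto
      then show ?thesis using that \<open>y \<in> border x\<close> by (simp add: border_def)
    qed
    moreover have "e \<le> U y' x'" if "x' \<in> {x<..1}" "y' \<in> {y<..1}" for x' y'
    proof -
      have "U y' x' = U x' y'" using commute[of x' y'] that \<open>x \<in> {0..1}\<close> \<open>y \<in> {0..1}\<close> by auto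
      then show ?thesis using that \<open>y \<in> border x\<close> by (simp add: border_def)
    qed
    ultimately show ?thesis using \<open>x \<in> {0..1}\<close> by (simp add: border_def)
  qed
  then show ?thesis unfolding symmetric_def by blast
qed

lemma surjective_border: "surjective border"
  unfolding surjective_def
proof
  fix y :: real assume y: "y \<in> {0..1}"
  define A where "A = insert 0 {x \<in> {0..1}. U x y < e}"
  \<comment> \<open>Inserting 0 makes the supremum meaningful when \<open>U x y < e\<close> has no solution \<open>x\<close>.\<close>
  have A: "A \<subseteq> {0..1}" "A \<noteq> {}" by (auto simp: A_def)
  then have bdd: "bdd_above A" by (meson bdd_above_Icc bdd_above_mono)
  define s where "s = Sup A"
  have "0 \<le> s" unfolding s_def by (rule cSup_upper[OF _ bdd]) (simp add: A_def)
  moreover have "s \<le> 1" unfolding s_def by (rule cSup_least) (use A in auto)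
  ultimately have s: "s \<in> {0..1}" by simp
  have "U x' y' \<le> e" if x': "x' \<in> {0..<s}" and y': "y' \<in> {0..<y}" for x' y'
  proof -
    obtain x where "x \<in> A" "x' < x"
      using less_cSupD[OF A(2), of x'] x' by (auto simp: s_def)
    then have "x \<in> {0..1}" "U x y < e" using x' by (auto simp: A_def)
    then show ?thesis using mono[of x' x y' y] x' y' y \<open>x' < x\<close> by auto
  qed
  moreover have "e \<le> U x' y'" if x': "x' \<in> {s<..1}" and y': "y' \<in> {y<..1}" for x' y'
  proof -
    have "x' \<notin> A" using cSup_upper[OF _ bdd, of x'] x' by (auto simp: s_def)
    then have "e \<le> U x' y" using x' s by (auto simp: A_def)
    also have "\<dots> \<le> U x' y'" using mono[of x' x' y y'] x' y' y s by auto
    finally show ?thesis .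
  qed
  ultimately show "\<exists>x\<in>{0..1}. y \<in> border x"
    using y s by (intro bexI[of _ s]) (simp_all add: border_def)
qed

lemma non_increasing_border: "non_increasing border"
  unfolding non_increasing_def
proof (intro ballI impI, rule ccontr)
  fix x1 x2 y1 y2 :: real
  assume x: "x1 \<in> {0..1}" "x2 \<in> {0..1}" "x1 < x2"
    and y: "y1 \<in> border x1" "y2 \<in> border x2" and "\<not> y1 \<ge> y2"
  then have y01: "y1 \<in> {0..1}" "y2 \<in> {0..1}" "y1 < y2" by (auto simp: border_def)
  have rect: "U x' y' = e" if "x' \<in> {x1<..<x2}" "y' \<in> {y1<..<y2}" for x' y'
  proof (rule antisym)
    show "U x' y' \<le> e" using y(2) that x y01 by (auto simp: border_def)
    show "e \<le> U x' y'" using y(1) that x y01 by (auto simp: border_def)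
  qed
  obtain a where a: "x1 < a" "a < x2" using dense x(3) by blast
  obtain a' where a': "a < a'" "a' < x2" using dense a(2) by blast
  obtain b where b: "y1 < b" "b < y2" using dense y01(3) by blast
  have "a = a'"
    by (rule inverse_unique[of a a' b]) (use rect a a' b x y01 in auto)
  then show False using a' by simp
qed

lemma continuous_off_border: "continuous_at_points_of (unit_square - graph_of border) U"
  unfolding continuous_at_points_of_def
proof (rule ballI, clarify)
  fix x y :: real
  assume xy: "x \<in> {0..1}" "y \<in> {0..1}" and "(x, y) \<notin> graph_of border"
  then have "y \<notin> border x" by (auto simp: graph_of_def)
  then consider (above) a b where "a \<in> {0..<x}" "b \<in> {0..<y}" "e < U a b"
    | (below) a b where "a \<in> {x<..1}" "b \<in> {y<..1}" "U a b < e"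
    using xy by (auto simp: border_def not_le)
  then show "continuous (at (x, y) within unit_square) (\<lambda>(x, y). U x y)"
  proof cases
    case above
    then show ?thesis using continuous_strictly_above[of a b x y] xy by auto
  next
    case below
    then show ?thesis using continuous_strictly_below[of a b x y] xy by auto
  qed
qed

lemma neutral_level_subset_border:
  assumes "x \<in> {0..1}" "y \<in> {0..1}" "U x y = e"
  shows "(x, y) \<in> graph_of border"
proof -
  have "U x' y' \<le> e" if "x' \<in> {0..<x}" "y' \<in> {0..<y}" for x' y'
    using mono[of x' x y' y] that assms by auto
  moreover have "e \<le> U x' y'" if "x' \<in> {x<..1}" "y' \<in> {y<..1}" for x' y'
    using mono[of x x' y y'] that assms by auto
  ultimately show ?thesis using assms(1,2) by (auto simp: graph_of_def border_def)
qed

end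

section \<open>Continuous underlying operations\<close>

lemma uninorm_neutral_unique:
  assumes "uninorm U e" "uninorm U e'"
  shows "e = e'"
proof -
  have e: "e \<in> {0..1}" "e' \<in> {0..1}"
    using assms by (auto simp: uninorm_def)
  have "e' = U e e'" using assms(1) e unfolding uninorm_def by metis
  also have "\<dots> = U e' e" using assms(1) e unfolding uninorm_def by blast
  also have "\<dots> = e" using assms(2) e unfolding uninorm_def by blast
  finally show ?thesis by simp
qed

text \<open>
  For \<open>c \<ge> e\<close> the section \<open>U c\<close> is continuous on \<open>[e, 1]\<close>, where it runs from \<open>U c e = c\<close> to
  \<open>U c 1 = 1\<close>, so the intermediate value theorem solves the equation; similarly on \<open>[0, e]\<close>.
\<close>

lemma solvable_uninorm_if_cont_underlying:
  assumes U: "uninorm U e" and "U \<in> uninorms_cont_underlying"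
  shows "solvable_uninorm U e"
proof
  have T: "continuous_on unit_square (\<lambda>(x, y). underlying_tnorm U e x y)"
    and S: "continuous_on unit_square (\<lambda>(x, y). underlying_tconorm U e x y)"
    using assms uninorm_neutral_unique by (auto simp: uninorms_cont_underlying_def)
  have e: "0 < e" "e < 1" using U by (auto simp: uninorm_def)
  have closed: "U x y \<in> {0..1}" and comm: "U x y = U y x"
    if "x \<in> {0..1}" "y \<in> {0..1}" for x y
    using U that unfolding uninorm_def by blast+
  have neutral: "U e x = x" if "x \<in> {0..1}" for x
    using U that unfolding uninorm_def by blast
  have mono: "U x y \<le> U x' y" if "x \<in> {0..1}" "x' \<in> {0..1}" "y \<in> {0..1}" "x \<le> x'" for x x' y
    using U that unfolding uninorm_def by blast
  show "uninorm U e" by fact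
  fix c v :: real
  {
    assume c: "e \<le> c" "c \<le> v" "v \<le> 1"
    define c' where "c' = (c - e) / (1 - e)"
    have c': "c' \<in> {0..1}" "e + (1 - e) * c' = c"
      using c e by (auto simp: c'_def field_simps)
    have "continuous_on {0..1} (\<lambda>t. (\<lambda>(x, y). underlying_tconorm U e x y) (c', t))"
      by (rule continuous_on_compose2[OF S]) (use c' in \<open>auto intro!: continuous_intros\<close>)
    then have cont: "continuous_on {0..1} (\<lambda>t. underlying_tconorm U e c' t * (1 - e) + e)"
      by (auto intro!: continuous_intros)
    have eq: "underlying_tconorm U e c' t * (1 - e) + e = U c (e + (1 - e) * t)" for t
      using e c' by (simp add: underlying_tconorm_def)
    have "U c 1 = 1"
      using mono[of e c 1] closed[of c 1] neutral[of 1] c e by auto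
    moreover have "U c e = c"
      using comm[of c e] neutral[of c] c e by auto
    ultimately obtain t where t: "0 \<le> t" "t \<le> 1" "U c (e + (1 - e) * t) = v"
      using IVT'[OF _ _ _ cont, of v] c eq by auto
    have "(1 - e) * t \<le> 1 - e" using mult_left_le[of t "1 - e"] t e by linarith
    then have "e + (1 - e) * t \<le> 1" by linarith
    then show "\<exists>t\<in>{e..1}. U c t = v"
      using t e by (intro bexI[of _ "e + (1 - e) * t"]) auto
  next
    assume c: "0 \<le> v" "v \<le> c" "c \<le> e"
    define c' where "c' = c / e"
    have c': "c' \<in> {0..1}" "e * c' = c"
      using c e by (auto simp: c'_def field_simps)
    have "continuous_on {0..1} (\<lambda>t. (\<lambda>(x, y). underlying_tnorm U e x y) (c', t))"
      by (rule continuous_on_compose2[OF T]) (use c' in \<open>auto intro!: continuous_intros\<close>)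
    then have cont: "continuous_on {0..1} (\<lambda>t. underlying_tnorm U e c' t * e)"
      by (auto intro!: continuous_intros)
    have eq: "underlying_tnorm U e c' t * e = U c (e * t)" for t
      using e c' by (simp add: underlying_tnorm_def)
    have "U c 0 = 0"
      using mono[of c e 0] closed[of c 0] neutral[of 0] c e by auto
    moreover have "U c e = c"
      using comm[of c e] neutral[of c] c e by auto
    ultimately obtain t where t: "0 \<le> t" "t \<le> 1" "U c (e * t) = v"
      using IVT'[OF _ _ _ cont, of v] c eq by auto
    have "e * t \<le> e" using mult_left_mono[of t 1 e] t e by simp
    then show "\<exists>t\<in>{0..e}. U c t = v"
      using t e by (intro bexI[of _ "e * t"]) auto
  }
qed

theorem corollary2:
  fixes U :: "real \<Rightarrow> real \<Rightarrow> real" and e :: real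
  assumes "uninorm U e"
    and "U \<in> uninorms_cont_underlying"
  shows "(\<exists>r. set_valued_function r \<and> symmetric r \<and> surjective r \<and> non_increasing r \<and>
            continuous_at_points_of (unit_square - graph_of r) U \<and>
            (\<forall>x\<in>{0..1}. \<forall>y\<in>{0..1}. U x y = e \<longrightarrow> (x, y) \<in> graph_of r)) \<and>
         (\<forall>x\<in>{0..1}. \<forall>y\<in>{0..1}. left_continuous_at U x y \<or> right_continuous_at U x y)"
proof -
  interpret solvable_uninorm U e
    using solvable_uninorm_if_cont_underlying assms by blast
  have "set_valued_function border"
    by (auto simp: set_valued_function_def border_def)
  moreover have "left_continuous_at U x y \<or> right_continuous_at U x y"
    if "x \<in> {0..1}" "y \<in> {0..1}" for x y
    using left_continuous_if_le[OF that] right_continuous_if_ge[OF that] by linarith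
  ultimately show ?thesis
    using symmetric_border surjective_border non_increasing_border continuous_off_border
      neutral_level_subset_border by blast
qed

end
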